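(* Let $K$ be a field. The coproduct $\Delta$ on the free 2-associative algebra $T(\mathbb T_\infty)$ on one generator is given recursively by the following formula: for a planar tree $t=t^1\vee\cdots\vee t^r$ with $r\geq 2$, $$\Delta(t^1\vee\cdots\vee t^r)=1\otimes t+\sum_{i=1}^r\Big(\bigvee(t^1,\dots,t^{i-1})\cdot t^i_{\{1\}}\Big)\otimes\Big(t^i_{\{2\}}\cdot\bigvee(t^{i+1},\dots,t^r)\Big),$$ where $\bigvee(t^1,\dots,t^k)=t^1\vee\cdots\vee t^k$ if $k>1$, $\bigvee(t^1)=t^{1(1)}*\cdots*t^{1(n)}$ if $k=1$ and $t^1=t^{1(1)}\vee\cdots\vee t^{1(n)}$, the empty $\bigvee$ is $1$, and for a tree $s=s^1\vee\cdots\vee s^k$ one writes (summation understood) $s_{\{1\}}\otimes s_{\{2\}}:=\Delta(s^1*\cdots*s^k)-1\otimes(s^1*\cdots*s^k)$.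
   Context: Trees. $\mathbb T_n$ is the set of planar rooted trees with $n$ leaves in which every internal vertex has at least two inputs; $\mathbb T_1=\{|\}$ is the trivial tree; $\mathbb T_\infty=\bigcup_{n\ge1}\mathbb T_n$. The grafting $t^1\vee\cdots\vee t^k$ joins the roots of $t^1,\dots,t^k$ to a new vertex and adds a new root. Any nontrivial tree is uniquely $t^1\vee\cdots\vee t^k$ with $k\ge2$; for $t=|$ the convention is $k=1$, $t^1=|$ (so $\bigvee(|)=|$). A 2-associative algebra is a $K$-vector space with two associative products $*$, $\cdot$ having a common unit $1$. The free one on one generator is $T(\mathbb T_\infty)$, the tensor algebra on $K[\mathbb T_\infty]$ with generator $|$, with $*$ = concatenation (basis: the monomials $t_1*\cdots*t_k$), and $\cdot$ with unit $1$ given by $s\cdot t=s^1\vee\cdots\vee s^m\vee t^1\vee\cdots\vee t^n$, $(s_1*\cdots*s_k)\cdot t=(s_1\vee\cdots\vee s_k)\vee t^1\vee\cdots\vee t^n$ for $k\ge2$, $s\cdot(t_1*\cdots*t_l)=s^1\vee\cdots\vee s^m\vee(t_1\vee\cdots\vee t_l)$ for $l\ge2$, $(s_1*\cdots*s_k)\cdot(t_1*\cdots*t_l)=(s_1\vee\cdots\vee s_k)\vee(t_1\vee\cdots\vee t_l)$ for $k,l\ge2$, where $s=s^1\vee\cdots\vee s^m$, $t=t^1\vee\cdots\vee t^n$. The coproduct $\Delta$ is the unique linear map $T(\mathbb T_\infty)\to T(\mathbb T_\infty)\otimes T(\mathbb T_\infty)$ with $\Delta(1)=1\otimes1$, $\Delta(|)=|\otimes1+1\otimes|$,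 $\Delta(x*y)=\Delta(x)*\Delta(y)$, $\Delta(x\cdot y)=(x\otimes1)\cdot\Delta(y)+\Delta(x)\cdot(1\otimes y)-x\otimes y$ (products on the tensor square being componentwise). *)

theory Defs
  imports Complex_Main "HOL-Library.Poly_Mapping"
begin

text \<open>
  Planar rooted trees all of whose internal vertices have at least two inputs: the first two
  inputs are separate constructor arguments, so the type is exactly the set of all such trees.
\<close>

datatype ptree = Leaf | Node ptree ptree "ptree list"

text \<open>Grafting \<open>t\<^sup>1 \<or> \<dots> \<or> t\<^sup>k\<close> for \<open>k \<ge> 2\<close>, with the convention that grafting \<open>|\<close> alone gives \<open>|\<close>;
  the remaining values for \<open>k < 2\<close> are dummies.\<close>

fun graft :: "ptree list \<Rightarrow> ptree" where
  "graft (s # t # ts) = Node s t ts"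
| "graft [t] = t"
| "graft [] = Leaf"

text \<open>The unique list \<open>t\<^sup>1, \<dots>, t\<^sup>k\<close> with \<open>t = t\<^sup>1 \<or> \<dots> \<or> t\<^sup>k\<close>, where the trivial tree has \<open>k = 1\<close>.\<close>

fun branches :: "ptree \<Rightarrow> ptree list" where
  "branches Leaf = [Leaf]"
| "branches (Node s t ts) = s # t # ts"

text \<open>A forest \<open>[t\<^sub>1, \<dots>, t\<^sub>k]\<close> stands for the monomial \<open>t\<^sub>1 * \<dots> * t\<^sub>k\<close>, with \<open>[]\<close> for the unit.\<close>

type_synonym forest = "ptree list"

text \<open>
  \<open>T(\<T>\<^sub>\<infinity>)\<close> is the vector space with basis the forests. Its tensor square is modelled by the
  vector space with basis the pairs of forests, \<open>(a, b)\<close> being the basis vector \<open>a \<otimes> b\<close>.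
\<close>

type_synonym 'k forest_alg = "forest \<Rightarrow>\<^sub>0 'k"
type_synonym 'k forest_alg2 = "(forest \<times> forest) \<Rightarrow>\<^sub>0 'k"

definition scale :: "'k::field \<Rightarrow> ('a \<Rightarrow>\<^sub>0 'k) \<Rightarrow> ('a \<Rightarrow>\<^sub>0 'k)" where
  "scale c = Poly_Mapping.map ((*) c)"

abbreviation monomial :: "'a \<Rightarrow> ('a \<Rightarrow>\<^sub>0 'k::field)" where
  "monomial a \<equiv> Poly_Mapping.single a 1"

abbreviation unit_elt :: "'k::field forest_alg" (\<open>\<one>\<close>) where
  "\<one> \<equiv> monomial []"

text \<open>Bilinear extension of an operation on basis vectors.\<close>

definition bilin_ext ::
  "('a \<Rightarrow> 'b \<Rightarrow> 'c) \<Rightarrow> ('a \<Rightarrow>\<^sub>0 'k::field) \<Rightarrow> ('b \<Rightarrow>\<^sub>0 'k) \<Rightarrow> ('c \<Rightarrow>\<^sub>0 'k)" where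
  "bilin_ext f x y =
    (\<Sum>a\<in>Poly_Mapping.keys x. \<Sum>b\<in>Poly_Mapping.keys y.
      Poly_Mapping.single (f a b) (Poly_Mapping.lookup x a * Poly_Mapping.lookup y b))"

fun dot_forest :: "forest \<Rightarrow> forest \<Rightarrow> forest" where
  "dot_forest [] w = w"
| "dot_forest (s # ss) [] = s # ss"
| "dot_forest [s] [t] = [graft (branches s @ branches t)]"
| "dot_forest (s1 # s2 # ss) [t] = [graft (graft (s1 # s2 # ss) # branches t)]"
| "dot_forest [s] (t1 # t2 # ts) = [graft (branches s @ [graft (t1 # t2 # ts)])]"
| "dot_forest (s1 # s2 # ss) (t1 # t2 # ts) =
     [graft [graft (s1 # s2 # ss), graft (t1 # t2 # ts)]]"

definition star :: "'k::field forest_alg \<Rightarrow> 'k forest_alg \<Rightarrow> 'k forest_alg" (infixl \<open>\<star>\<close> 70) where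
  "x \<star> y = bilin_ext (@) x y"

definition dot :: "'k::field forest_alg \<Rightarrow> 'k forest_alg \<Rightarrow> 'k forest_alg" (infixl \<open>\<odot>\<close> 70) where
  "x \<odot> y = bilin_ext dot_forest x y"

definition tensor :: "'k::field forest_alg \<Rightarrow> 'k forest_alg \<Rightarrow> 'k forest_alg2" (infixl \<open>\<otimes>\<close> 68) where
  "x \<otimes> y = bilin_ext Pair x y"

definition star2 :: "'k::field forest_alg2 \<Rightarrow> 'k forest_alg2 \<Rightarrow> 'k forest_alg2" (infixl \<open>\<star>\<^sub>2\<close> 66) where
  "u \<star>\<^sub>2 v = bilin_ext (\<lambda>(a, b) (c, d). (a @ c, b @ d)) u v"

definition dot2 :: "'k::field forest_alg2 \<Rightarrow> 'k forest_alg2 \<Rightarrow> 'k forest_alg2" (infixl \<open>\<odot>\<^sub>2\<close> 66) where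
  "u \<odot>\<^sub>2 v = bilin_ext (\<lambda>(a, b) (c, d). (dot_forest a c, dot_forest b d)) u v"

definition is_coproduct :: "('k::field forest_alg \<Rightarrow> 'k forest_alg2) \<Rightarrow> bool" where
  "is_coproduct D \<longleftrightarrow>
     Vector_Spaces.linear scale scale D \<and>
     D \<one> = \<one> \<otimes> \<one> \<and>
     D (monomial [Leaf]) = monomial [Leaf] \<otimes> \<one> + \<one> \<otimes> monomial [Leaf] \<and>
     (\<forall>x y. D (x \<star> y) = D x \<star>\<^sub>2 D y) \<and>
     (\<forall>x y. D (x \<odot> y) = ((x \<otimes> \<one>) \<odot>\<^sub>2 D y) + (D x \<odot>\<^sub>2 (\<one> \<otimes> y)) - x \<otimes> y)"

definition coproduct :: "'k::field forest_alg \<Rightarrow> 'k forest_alg2" (\<open>\<Delta>\<close>) where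
  "\<Delta> = (THE D. is_coproduct D)"

text \<open>
  The expression \<open>\<Or>(t\<^sup>1, \<dots>, t\<^sup>k)\<close>. For \<open>k = 1\<close> it is not the tree \<open>t\<^sup>1\<close> but the \<open>*\<close>-product of
  the branches of \<open>t\<^sup>1\<close>.
\<close>

fun bigvee_forest :: "ptree list \<Rightarrow> forest" where
  "bigvee_forest [] = []"
| "bigvee_forest [t] = branches t"
| "bigvee_forest (s # t # ts) = [graft (s # t # ts)]"

definition bigvee :: "ptree list \<Rightarrow> 'k::field forest_alg" where
  "bigvee ts = monomial (bigvee_forest ts)"

text \<open>The element written \<open>s\<^bsub>{1}\<^esub> \<otimes> s\<^bsub>{2}\<^esub>\<close> in Sweedler notation.\<close>

definition reduced :: "ptree \<Rightarrow> 'k::field forest_alg2" where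
  "reduced s = \<Delta> (monomial (branches s)) - \<one> \<otimes> monomial (branches s)"

text \<open>
  For bilinear \<open>F\<close>, \<open>sweedler u F\<close> is the summation \<open>F u\<^bsub>{1}\<^esub> u\<^bsub>{2}\<^esub>\<close> understood in Sweedler
  notation, i.e. the value at \<open>u\<close> of the linear map sending \<open>p \<otimes> q\<close> to \<open>F p q\<close>.
\<close>

definition sweedler ::
  "'k::field forest_alg2 \<Rightarrow> ('k forest_alg \<Rightarrow> 'k forest_alg \<Rightarrow> 'k forest_alg2) \<Rightarrow> 'k forest_alg2" where
  "sweedler u F =
    (\<Sum>(a, b)\<in>Poly_Mapping.keys u.
      scale (Poly_Mapping.lookup u (a, b)) (F (monomial a) (monomial b)))"

end

theory Submission
  imports Defs
begin

text \<open>
  The map \<^const>\<open>bigvee_forest\<close> is an involution which turns concatenation into the product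
  \<open>\<odot>\<close>: \<open>\<Or>(s\<^sup>1, \<dots>, s\<^sup>m) \<odot> \<Or>(t\<^sup>1, \<dots>, t\<^sup>n) = \<Or>(s\<^sup>1, \<dots>, s\<^sup>m, t\<^sup>1, \<dots>, t\<^sup>n)\<close>. Hence the
  algebra is also free for \<open>\<odot>\<close>, on the generators \<open>\<Or>(t)\<close>. The
  infinitesimal relation for \<open>D\<close> says that \<open>E x = D x - \<one> \<otimes> x\<close> satisfies
  \<open>E (x \<odot> y) = E x \<odot>\<^sub>2 (\<one> \<otimes> y) + (x \<otimes> \<one>) \<odot>\<^sub>2 E y\<close>, and unfolding this along
  \<open>\<Or>(t\<^sup>1, \<dots>, t\<^sup>r) = \<Or>(t\<^sup>1) \<odot> \<dots> \<odot> \<Or>(t\<^sup>r)\<close> gives the formula for every coproduct.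
  Conversely, the formula together with multiplicativity for \<open>\<star>\<close> is a well-founded recursion,
  whose solution is a coproduct; so the coproduct exists and is unique.
\<close>

section \<open>Linear and bilinear extension from a basis\<close>

lemma lookup_scale: "Poly_Mapping.lookup (scale c x) a = c * Poly_Mapping.lookup x a"
  unfolding scale_def by (simp add: Poly_Mapping.map.rep_eq when_def)

lemma vector_space_scale: "vector_space (scale :: 'k::field \<Rightarrow> ('a \<Rightarrow>\<^sub>0 'k) \<Rightarrow> _)"
  by standard (auto intro!: poly_mapping_eqI simp: lookup_scale lookup_add algebra_simps)

interpretation scale: vector_space "scale :: 'k::field \<Rightarrow> ('a \<Rightarrow>\<^sub>0 'k) \<Rightarrow> _"
  by (rule vector_space_scale)

lemma scale_single [simp]: "scale c (Poly_Mapping.single a d) = Poly_Mapping.single a (c * d)"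
  by (rule poly_mapping_eqI) (simp add: lookup_scale lookup_single when_def)

definition lin_ext :: "('a \<Rightarrow> ('b \<Rightarrow>\<^sub>0 'k)) \<Rightarrow> ('a \<Rightarrow>\<^sub>0 'k::field) \<Rightarrow> ('b \<Rightarrow>\<^sub>0 'k)" where
  "lin_ext f x = (\<Sum>a\<in>Poly_Mapping.keys x. scale (Poly_Mapping.lookup x a) (f a))"

text \<open>Enlarging the index set adds only zero terms. This lets sums over the different supports
  of \<open>x\<close>, \<open>y\<close> and \<open>x + y\<close> be compared over one common
  set.\<close>

lemma lin_ext_superset:
  assumes "finite A" "Poly_Mapping.keys x \<subseteq> A"
  shows "lin_ext f x = (\<Sum>a\<in>A. scale (Poly_Mapping.lookup x a) (f a))"
  unfolding lin_ext_def
  by (rule sum.mono_neutral_left) (use assms in \<open>auto simp: in_keys_iff\<close>)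

lemma lin_ext_add: "lin_ext f (x + y) = lin_ext f x + lin_ext f y"
proof -
  let ?A = "Poly_Mapping.keys x \<union> Poly_Mapping.keys y"
  have "lin_ext f z = (\<Sum>a\<in>?A. scale (Poly_Mapping.lookup z a) (f a))"
    if "Poly_Mapping.keys z \<subseteq> ?A" for z
    by (rule lin_ext_superset) (use that in auto)
  then show ?thesis
    using Poly_Mapping.keys_add[of x y]
    by (simp add: lookup_add scale.scale_left_distrib sum.distrib)
qed

lemma lin_ext_scale: "lin_ext f (scale c x) = scale c (lin_ext f x)"
proof -
  have "Poly_Mapping.keys (scale c x) \<subseteq> Poly_Mapping.keys x"
    by (auto simp: in_keys_iff lookup_scale)
  then have "lin_ext f (scale c x) =
      (\<Sum>a\<in>Poly_Mapping.keys x. scale (Poly_Mapping.lookup (scale c x) a) (f a))"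
    by (intro lin_ext_superset) auto
  then show ?thesis
    by (simp add: lookup_scale lin_ext_def scale.scale_sum_right)
qed

lemma linear_lin_ext: "Vector_Spaces.linear scale scale (lin_ext f)"
  by (intro Vector_Spaces.linear_iff[THEN iffD2] conjI vector_space_scale allI lin_ext_add lin_ext_scale)

lemma lin_ext_single [simp]: "lin_ext f (Poly_Mapping.single a c) = scale c (f a)"
  by (simp add: lin_ext_def)

lemma bilin_ext_eq_lin_ext:
  "bilin_ext f x y = lin_ext (\<lambda>a. lin_ext (\<lambda>b. monomial (f a b)) y) x"
  by (simp add: bilin_ext_def lin_ext_def scale.scale_sum_right)

lemma poly_mapping_sum_keys:
  "x = (\<Sum>a\<in>Poly_Mapping.keys x. Poly_Mapping.single a (Poly_Mapping.lookup x a))"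
  by (rule poly_mapping_eqI)
     (simp add: lookup_sum lookup_single when_def in_keys_iff)

lemma poly_mapping_single_add_induct [case_names single add]:
  fixes x :: "'a \<Rightarrow>\<^sub>0 'b::comm_monoid_add"
  assumes single: "\<And>a c. P (Poly_Mapping.single a c)"
    and add: "\<And>x y. P x \<Longrightarrow> P y \<Longrightarrow> P (x + y)"
  shows "P x"
proof -
  have "P (\<Sum>a\<in>A. Poly_Mapping.single a (Poly_Mapping.lookup x a))" if "finite A" for A
    using that
  proof induction
    case empty
    \<comment> \<open>The zero vector is a basis vector with coefficient 0, so the induction rule
      has no separate zero case.\<close>
    show ?case using single[of undefined 0] by simp
  qed (simp add: single add)
  then show ?thesis
    by (subst poly_mapping_sum_keys) simp
qed

lemma linear_bilin_ext_left: "Vector_Spaces.linear scale scale (\<lambda>x. bilin_ext f x y)"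
  by (simp add: bilin_ext_eq_lin_ext linear_lin_ext)

lemma linear_bilin_ext_right: "Vector_Spaces.linear scale scale (bilin_ext f x)"
  unfolding bilin_ext_eq_lin_ext Vector_Spaces.linear_iff lin_ext_add lin_ext_scale
  by (auto simp: lin_ext_def vector_space_scale scale.scale_right_distrib sum.distrib
      scale.scale_sum_right mult_ac)

lemma bilin_ext_single:
  "bilin_ext f (Poly_Mapping.single a c) (Poly_Mapping.single b d) = Poly_Mapping.single (f a b) (c * d)"
  by (simp add: bilin_ext_eq_lin_ext)

context
  fixes f :: "'a \<Rightarrow> 'b \<Rightarrow> 'c" and x :: "'a \<Rightarrow>\<^sub>0 'k::field" and y :: "'b \<Rightarrow>\<^sub>0 'k"
begin

interpretation L: Vector_Spaces.linear scale scale "\<lambda>x. bilin_ext f x y"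
  by (rule linear_bilin_ext_left)

interpretation R: Vector_Spaces.linear scale scale "bilin_ext f x"
  by (rule linear_bilin_ext_right)

lemmas bilin_ext_add_left = L.add
lemmas bilin_ext_add_right = R.add
lemmas bilin_ext_diff_left = L.diff
lemmas bilin_ext_zero_left = L.zero
lemmas bilin_ext_zero_right = R.zero
lemmas bilin_ext_sum_right = R.sum
lemmas bilin_ext_scale_left = L.scale
lemmas bilin_ext_scale_right = R.scale

end

lemma bilin_ext_assoc:
  assumes "\<And>a b c. g (f a b) c = g' a (f' b c)"
  shows "bilin_ext g (bilin_ext f x y) z = bilin_ext g' x (bilin_ext f' y z)"
proof (induction x rule: poly_mapping_single_add_induct)
  case (single a c)
  show ?case
  proof (induction y rule: poly_mapping_single_add_induct)
    case (single b d)
    show ?case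
      by (induction z rule: poly_mapping_single_add_induct)
         (simp_all add: bilin_ext_single bilin_ext_add_right assms mult.assoc)
  qed (simp add: bilin_ext_add_left bilin_ext_add_right)
qed (simp add: bilin_ext_add_left)

lemma bilin_ext_unit_left:
  assumes "\<And>b. f e b = b"
  shows "bilin_ext f (monomial e) y = y"
  by (induction y rule: poly_mapping_single_add_induct)
     (simp_all add: bilin_ext_single bilin_ext_add_right assms)

lemma bilin_ext_unit_right:
  assumes "\<And>a. f a e = a"
  shows "bilin_ext f x (monomial e) = x"
  by (induction x rule: poly_mapping_single_add_induct)
     (simp_all add: bilin_ext_single bilin_ext_add_left assms)

lemma linear_eq_on_basis:
  assumes "Vector_Spaces.linear scale scale F" "Vector_Spaces.linear scale scale G"
    and "\<And>a. F (monomial a) = G (monomial a)"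
  shows "F x = G x"
proof -
  interpret F: Vector_Spaces.linear scale scale F by fact
  interpret G: Vector_Spaces.linear scale scale G by fact
  show ?thesis
  proof (induction x rule: poly_mapping_single_add_induct)
    case (single a c)
    have "Poly_Mapping.single a c = scale c (monomial a)" by simp
    then show ?case using assms(3) by (metis F.scale G.scale)
  qed (simp add: F.add G.add)
qed

section \<open>Concatenation as a model of the product \<open>\<odot>\<close>\<close>

text \<open>A nontrivial tree, as a one-element list, is exchanged with the list of its branches;
  \<open>[]\<close> and \<open>[Leaf]\<close> are fixed.\<close>

lemma bigvee_forest_invol [simp]: "bigvee_forest (bigvee_forest ts) = ts"
  by (cases ts rule: bigvee_forest.cases; cases "hd ts") auto

lemma dot_forest_bigvee:
  "dot_forest (bigvee_forest ss) (bigvee_forest ts) = bigvee_forest (ss @ ts)"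
  \<comment> \<open>For a one-element list, the shape of its tree decides whether the image has one
    entry (\<open>Leaf\<close>) or at least two (\<open>Node\<close>), and hence which clause of
    \<open>dot_forest\<close> applies.\<close>
  by (cases ss rule: bigvee_forest.cases; cases "hd ss";
      cases ts rule: bigvee_forest.cases; cases "hd ts") auto

lemma dot_forest_eq: "dot_forest v w = bigvee_forest (bigvee_forest v @ bigvee_forest w)"
  using dot_forest_bigvee[of "bigvee_forest v" "bigvee_forest w"] by simp

lemma dot_forest_assoc: "dot_forest (dot_forest u v) w = dot_forest u (dot_forest v w)"
  by (simp add: dot_forest_eq)

lemma dot_forest_Nil_right [simp]: "dot_forest v [] = v"
  by (cases v) auto

lemma dot2_assoc: "u \<odot>\<^sub>2 v \<odot>\<^sub>2 w = u \<odot>\<^sub>2 (v \<odot>\<^sub>2 w)"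
  unfolding dot2_def by (rule bilin_ext_assoc) (auto simp: dot_forest_assoc)

lemma star2_assoc: "u \<star>\<^sub>2 v \<star>\<^sub>2 w = u \<star>\<^sub>2 (v \<star>\<^sub>2 w)"
  unfolding star2_def by (rule bilin_ext_assoc) auto

lemma tensor_monomial [simp]: "monomial a \<otimes> monomial b = monomial (a, b)"
  by (simp add: tensor_def bilin_ext_single)

lemma star_monomial [simp]: "monomial a \<star> monomial b = monomial (a @ b)"
  by (simp add: star_def bilin_ext_single)

lemma dot_monomial [simp]: "monomial a \<odot> monomial b = monomial (dot_forest a b)"
  by (simp add: dot_def bilin_ext_single)

lemma dot2_monomial [simp]:
  "monomial (a, b) \<odot>\<^sub>2 monomial (c, d) = monomial (dot_forest a c, dot_forest b d)"
  by (simp add: dot2_def bilin_ext_single)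

lemma dot2_unit_left [simp]: "monomial ([], []) \<odot>\<^sub>2 u = u"
  unfolding dot2_def by (rule bilin_ext_unit_left) auto

lemma dot2_unit_right [simp]: "u \<odot>\<^sub>2 monomial ([], []) = u"
  unfolding dot2_def by (rule bilin_ext_unit_right) auto

lemma star2_unit_left [simp]: "monomial ([], []) \<star>\<^sub>2 u = u"
  unfolding star2_def by (rule bilin_ext_unit_left) auto

lemma star2_unit_right [simp]: "u \<star>\<^sub>2 monomial ([], []) = u"
  unfolding star2_def by (rule bilin_ext_unit_right) auto

lemmas dot2_add_left = bilin_ext_add_left[of "\<lambda>(a, b) (c, d). (dot_forest a c, dot_forest b d)", folded dot2_def]
lemmas dot2_add_right = bilin_ext_add_right[of "\<lambda>(a, b) (c, d). (dot_forest a c, dot_forest b d)", folded dot2_def]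
lemmas dot2_diff_left = bilin_ext_diff_left[of "\<lambda>(a, b) (c, d). (dot_forest a c, dot_forest b d)", folded dot2_def]
lemmas dot2_zero_left = bilin_ext_zero_left[of "\<lambda>(a, b) (c, d). (dot_forest a c, dot_forest b d)", folded dot2_def]
lemmas dot2_zero_right = bilin_ext_zero_right[of "\<lambda>(a, b) (c, d). (dot_forest a c, dot_forest b d)", folded dot2_def]
lemmas dot2_sum_right = bilin_ext_sum_right[of "\<lambda>(a, b) (c, d). (dot_forest a c, dot_forest b d)", folded dot2_def]

section \<open>The sum in the coproduct formula\<close>

text \<open>The parameter \<open>u\<close> takes the place of the reduced coproduct of a branch, so
  that the same sum serves for the recursion, for an arbitrary coproduct and for
  \<open>\<Delta>\<close>.\<close>

definition graft_sum :: "(ptree \<Rightarrow> 'k::field forest_alg2) \<Rightarrow> ptree list \<Rightarrow> 'k forest_alg2" where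
  "graft_sum u ts = (\<Sum>i<length ts.
    (bigvee (take i ts) \<otimes> \<one>) \<odot>\<^sub>2 u (ts ! i) \<odot>\<^sub>2 (\<one> \<otimes> bigvee (drop (Suc i) ts)))"

text \<open>Only the values of \<open>u\<close> on members of the list matter. The function package
  uses this to confine the recursive calls of \<open>coproduct_forest\<close> to branches.\<close>

lemma graft_sum_cong [fundef_cong]:
  assumes "ts = ts'" "\<And>t. t \<in> set ts' \<Longrightarrow> u t = u' t"
  shows "graft_sum u ts = graft_sum u' ts'"
  unfolding graft_sum_def assms(1) by (intro sum.cong) (auto simp: assms(2))

lemma graft_sum_Nil: "graft_sum u [] = 0"
  by (simp add: graft_sum_def)

lemma bigvee_append_unit:
  "bigvee (ss @ ts) \<otimes> \<one> = (bigvee ss \<otimes> \<one>) \<odot>\<^sub>2 (bigvee ts \<otimes> \<one>)"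
  "\<one> \<otimes> bigvee (ss @ ts) = (\<one> \<otimes> bigvee ss) \<odot>\<^sub>2 (\<one> \<otimes> bigvee ts)"
  by (simp_all add: bigvee_def dot_forest_bigvee)

lemma bigvee_Cons_unit:
  "bigvee (t # ts) \<otimes> \<one> = monomial (branches t, []) \<odot>\<^sub>2 (bigvee ts \<otimes> \<one>)"
  using bigvee_append_unit(1)[of "[t]" ts] by (simp add: bigvee_def)

text \<open>The term for \<open>i = 0\<close> has the unit as its left factor; in all later terms
  the factor coming from \<open>t\<close> splits off on the left.\<close>

lemma graft_sum_Cons:
  "graft_sum u (t # ts) =
     (u t \<odot>\<^sub>2 (\<one> \<otimes> bigvee ts)) + (monomial (branches t, []) \<odot>\<^sub>2 graft_sum u ts)"
proof -
  have "(bigvee [] \<otimes> \<one>) \<odot>\<^sub>2 v = v" for v :: "'a forest_alg2"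
    by (simp add: bigvee_def)
  then show ?thesis
    by (simp add: graft_sum_def sum.lessThan_Suc_shift dot2_sum_right dot2_assoc bigvee_Cons_unit
        del: sum.lessThan_Suc)
qed

text \<open>This is the Leibniz rule for \<open>E\<close> from the overview, read off on
  lists.\<close>

lemma graft_sum_append:
  "graft_sum u (ss @ ts) =
     (graft_sum u ss \<odot>\<^sub>2 (\<one> \<otimes> bigvee ts)) + ((bigvee ss \<otimes> \<one>) \<odot>\<^sub>2 graft_sum u ts)"
proof (induction ss)
  case Nil
  show ?case by (simp add: graft_sum_Nil bigvee_def dot2_zero_left)
next
  case (Cons s ss)
  show ?case
    by (simp only: append_Cons graft_sum_Cons Cons bigvee_Cons_unit bigvee_append_unit(2)
        dot2_add_left dot2_add_right dot2_assoc add.assoc)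
qed

section \<open>Existence of the coproduct\<close>

text \<open>\<open>[Leaf]\<close> has its own clause because \<open>branches Leaf = [Leaf]\<close>
  would make the recursion call itself.\<close>

function coproduct_forest :: "forest \<Rightarrow> 'k::field forest_alg2" where
  "coproduct_forest [] = monomial ([], [])"
| "coproduct_forest [Leaf] = monomial ([Leaf], []) + monomial ([], [Leaf])"
| "coproduct_forest [Node s t ts] = monomial ([], [Node s t ts]) +
     graft_sum (\<lambda>r. coproduct_forest (branches r) - monomial ([], branches r)) (s # t # ts)"
| "coproduct_forest (s # t # ts) = coproduct_forest [s] \<star>\<^sub>2 coproduct_forest (t # ts)"
  by pat_completeness auto

text \<open>Thus \<open>branches t\<close> has the same measure as \<open>[t]\<close>, and passing
  from a tree to the branches of one of its branches decreases it.\<close>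

lemma size_list_branches: "size_list size (branches t) = Suc (size t)"
  by (cases t) auto

termination
proof (relation "measure (size_list size)"; (simp add: size_list_branches; fail)?)
  fix s t r :: ptree and ts
  assume "r \<in> set (s # t # ts)"
  then show "(branches r, [Node s t ts]) \<in> measure (size_list size)"
    using size_list_estimation'[of r ts "size r" size]
    by (auto simp: size_list_branches)
qed

lemma coproduct_forest_append:
  "coproduct_forest (v @ w) = coproduct_forest v \<star>\<^sub>2 coproduct_forest w"
proof (induction v)
  case (Cons t v)
  have *: "coproduct_forest (t # v) = coproduct_forest [t] \<star>\<^sub>2 coproduct_forest v" for v
    by (cases v) auto
  show ?case
    using Cons by (simp add: *[of v] *[of "v @ w"] star2_assoc)
qed simp

text \<open>For at least two trees this is the defining clause. For a single tree the sum is one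
  reduced term, and the identity is a tautology.\<close>

lemma coproduct_forest_bigvee:
  "coproduct_forest (bigvee_forest ts) = monomial ([], bigvee_forest ts) +
     graft_sum (\<lambda>r. coproduct_forest (branches r) - monomial ([], branches r)) ts"
  by (cases ts rule: bigvee_forest.cases)
     (simp_all add: graft_sum_Nil graft_sum_Cons dot2_zero_right, simp_all add: bigvee_def dot2_zero_right)

text \<open>With both forests written as \<open>bigvee_forest\<close> of lists, the Leibniz rule for
  \<open>graft_sum\<close> applies. The term \<open>monomial (v, w)\<close> produced by the first
  product cancels against the subtracted one.\<close>

lemma coproduct_forest_dot:
  "coproduct_forest (dot_forest v w) =
     (monomial (v, []) \<odot>\<^sub>2 coproduct_forest w) + (coproduct_forest v \<odot>\<^sub>2 monomial ([], w))
       - monomial (v, w)"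
proof -
  obtain ss ts where "v = bigvee_forest ss" "w = bigvee_forest ts"
    by (metis bigvee_forest_invol)
  then show ?thesis
    by (simp add: dot_forest_bigvee coproduct_forest_bigvee graft_sum_append dot2_add_left
        dot2_add_right) (simp add: bigvee_def dot_forest_bigvee)
qed

lemma is_coproduct_lin_ext_coproduct_forest:
  "is_coproduct (lin_ext coproduct_forest :: 'k::field forest_alg \<Rightarrow> _)"
  unfolding is_coproduct_def
proof (intro conjI allI linear_lin_ext)
  fix x y :: "'k forest_alg"
  show "lin_ext coproduct_forest (x \<star> y) = lin_ext coproduct_forest x \<star>\<^sub>2 lin_ext coproduct_forest y"
  proof (induction x rule: poly_mapping_single_add_induct)
    case (single v c)
    show ?case
    proof (induction y rule: poly_mapping_single_add_induct)
      case (single w d)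
      show ?case
        by (simp add: star_def star2_def bilin_ext_single bilin_ext_scale_left bilin_ext_scale_right
            coproduct_forest_append)
    qed (simp add: star_def star2_def lin_ext_add bilin_ext_add_right)
  qed (simp add: star_def star2_def lin_ext_add bilin_ext_add_left)
  show "lin_ext coproduct_forest (x \<odot> y) = (x \<otimes> \<one>) \<odot>\<^sub>2 lin_ext coproduct_forest y
      + (lin_ext coproduct_forest x \<odot>\<^sub>2 (\<one> \<otimes> y)) - x \<otimes> y"
  proof (induction x rule: poly_mapping_single_add_induct)
    case (single v c)
    show ?case
    proof (induction y rule: poly_mapping_single_add_induct)
      case (single w d)
      \<comment> \<open>The scalars are kept apart from the basis vectors so that bilinearity can
        pull them out before the identity on forests is used.\<close>
      have "lin_ext coproduct_forest (scale c (monomial v) \<odot> scale d (monomial w)) =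
          (scale c (monomial v) \<otimes> \<one>) \<odot>\<^sub>2 lin_ext coproduct_forest (scale d (monomial w))
          + (lin_ext coproduct_forest (scale c (monomial v)) \<odot>\<^sub>2 (\<one> \<otimes> scale d (monomial w)))
          - scale c (monomial v) \<otimes> scale d (monomial w)"
        by (simp add: dot_def tensor_def dot2_def bilin_ext_scale_left bilin_ext_scale_right lin_ext_scale
              del: scale_single)
           (simp only: dot_def[symmetric] dot2_def[symmetric] tensor_def[symmetric] dot_monomial
              tensor_monomial lin_ext_single scale.scale_one coproduct_forest_dot
              scale.scale_right_distrib scale.scale_right_diff_distrib)
      then show ?case by simp
    qed (simp add: dot_def dot2_def tensor_def lin_ext_add bilin_ext_add_left bilin_ext_add_right)
  qed (simp add: dot_def dot2_def tensor_def lin_ext_add bilin_ext_add_left bilin_ext_add_right)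
qed simp_all

section \<open>Uniqueness of the coproduct\<close>

text \<open>Splitting off \<open>bigvee [t]\<close> as a left factor for \<open>\<odot>\<close>, the
  infinitesimal relation reproduces the recursion \<open>graft_sum_Cons\<close>.\<close>

lemma is_coproduct_bigvee:
  assumes "is_coproduct D"
  shows "D (bigvee ts) = (\<one> \<otimes> bigvee ts) +
     graft_sum (\<lambda>r. D (monomial (branches r)) - \<one> \<otimes> monomial (branches r)) ts"
proof (induction ts)
  case Nil
  show ?case using assms by (simp add: is_coproduct_def bigvee_def graft_sum_Nil)
next
  case (Cons t ts)
  have "bigvee (t # ts) = bigvee [t] \<odot> (bigvee ts :: 'a forest_alg)"
    using dot_forest_bigvee[of "[t]" ts] by (simp add: bigvee_def)
  then have "D (bigvee (t # ts)) = ((bigvee [t] \<otimes> \<one>) \<odot>\<^sub>2 D (bigvee ts))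
      + (D (bigvee [t]) \<odot>\<^sub>2 (\<one> \<otimes> bigvee ts)) - bigvee [t] \<otimes> bigvee ts"
    using assms by (simp add: is_coproduct_def)
  then show ?case
    using dot_forest_bigvee[of "[t]" ts]
    by (simp add: Cons graft_sum_Cons dot2_add_right dot2_diff_left) (simp add: bigvee_def)
qed

text \<open>The induction follows the recursion: a nontrivial tree is treated by
  \<open>is_coproduct_bigvee\<close>, a longer forest by multiplicativity for
  \<open>\<star>\<close>.\<close>

lemma is_coproduct_unique:
  assumes "is_coproduct D"
  shows "D (monomial w) = coproduct_forest w"
proof (induction w rule: coproduct_forest.induct)
  case (3 s t ts)
  have "D (monomial [Node s t ts]) = monomial ([], [Node s t ts]) +
     graft_sum (\<lambda>r. D (monomial (branches r)) - \<one> \<otimes> monomial (branches r)) (s # t # ts)"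
    using is_coproduct_bigvee[OF assms, of "s # t # ts"] by (simp add: bigvee_def)
  also have "graft_sum (\<lambda>r. D (monomial (branches r)) - \<one> \<otimes> monomial (branches r)) (s # t # ts) =
      graft_sum (\<lambda>r. coproduct_forest (branches r) - monomial ([], branches r)) (s # t # ts)"
    by (rule graft_sum_cong) (simp_all add: 3)
  finally show ?case by simp
next
  case (4 s t ts)
  have "D (monomial (s # t # ts)) = D (monomial [s]) \<star>\<^sub>2 D (monomial (t # ts))"
    using assms by (metis append_Cons append_Nil is_coproduct_def star_monomial)
  then show ?case by (simp add: 4)
next
  case 1
  have "D \<one> = \<one> \<otimes> \<one>"
    using assms unfolding is_coproduct_def by blast
  then show ?case by simp
next
  case 2
  have "D (monomial [Leaf]) = monomial [Leaf] \<otimes> \<one> + \<one> \<otimes> monomial [Leaf]"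
    using assms unfolding is_coproduct_def by blast
  then show ?case by simp
qed

text \<open>Existence and uniqueness together make the definite description behind
  \<open>\<Delta>\<close> meaningful.\<close>

lemma is_coproduct_coproduct: "is_coproduct (\<Delta> :: 'k::field forest_alg \<Rightarrow> _)"
proof -
  have "\<Delta> = (lin_ext coproduct_forest :: 'k forest_alg \<Rightarrow> _)"
    unfolding coproduct_def
  proof (rule the_equality)
    show "is_coproduct (lin_ext coproduct_forest :: 'k forest_alg \<Rightarrow> _)"
      by (rule is_coproduct_lin_ext_coproduct_forest)
  next
    fix D :: "'k forest_alg \<Rightarrow> 'k forest_alg2"
    assume D: "is_coproduct D"
    then have "Vector_Spaces.linear scale scale D"
      by (simp only: is_coproduct_def)
    from linear_eq_on_basis[OF this linear_lin_ext] show "D = lin_ext coproduct_forest"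
      by (rule ext) (simp add: is_coproduct_unique[OF D])
  qed
  then show ?thesis
    using is_coproduct_lin_ext_coproduct_forest[where 'k = 'k] by (simp only:)
qed

section \<open>Sweedler notation and the formula\<close>

lemma sweedler_eq_lin_ext: "sweedler u F = lin_ext (\<lambda>(a, b). F (monomial a) (monomial b)) u"
  by (simp add: sweedler_def lin_ext_def split_def)

text \<open>On \<open>p \<otimes> q\<close> both sides are componentwise products, the outer factors
  acting on one component each and by the unit on the other; the rest is linearity in
  \<open>u\<close>.\<close>

lemma sweedler_sandwich:
  "sweedler u (\<lambda>p q. (monomial a \<odot> p) \<otimes> (q \<odot> monomial b)) =
     monomial (a, []) \<odot>\<^sub>2 u \<odot>\<^sub>2 monomial ([], b)"
proof (induction u rule: poly_mapping_single_add_induct)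
  case (single w c)
  show ?case
    by (cases w) (simp add: sweedler_eq_lin_ext dot2_def bilin_ext_single)
qed (simp add: sweedler_eq_lin_ext lin_ext_add dot2_add_left dot2_add_right)

theorem proposition6p2:
  fixes ts :: "ptree list"
  assumes "length ts \<ge> 2"
  shows "(\<Delta> (monomial [graft ts]) :: 'k::field forest_alg2) =
    \<one> \<otimes> monomial [graft ts] +
    (\<Sum>i<length ts. sweedler (reduced (ts ! i))
      (\<lambda>p q. (bigvee (take i ts) \<odot> p) \<otimes> (q \<odot> bigvee (drop (Suc i) ts))))"
proof -
  \<comment> \<open>With at least two trees, \<open>bigvee ts\<close> is the single tree
    \<open>graft ts\<close>; for one tree it would be the forest of its branches.\<close>
  obtain s t ts' where "ts = s # t # ts'"
    using assms by (cases ts rule: bigvee_forest.cases) auto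
  then have "bigvee ts = (monomial [graft ts] :: 'k forest_alg)"
    by (simp add: bigvee_def)
  moreover have "(\<Delta> (bigvee ts) :: 'k forest_alg2) = \<one> \<otimes> bigvee ts + graft_sum reduced ts"
    using is_coproduct_bigvee[OF is_coproduct_coproduct, of ts] by (simp only: reduced_def[abs_def])
  ultimately have "(\<Delta> (monomial [graft ts]) :: 'k forest_alg2) =
      \<one> \<otimes> monomial [graft ts] + graft_sum reduced ts"
    by (simp only:)
  then show ?thesis
    by (simp add: graft_sum_def bigvee_def sweedler_sandwich)
qed

end
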